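(* Let $\lambda$ be an arbitrary infinite cardinal, let $A$ be an arbitrary infinite subset of $\lambda$, and let $\tau_{\mathsf{fc}}^2$ be the topology on $\mathscr{I}_\lambda^2$ determined by $A$ as described in the context. Then $(\mathscr{I}_\lambda^2,\tau_{\mathsf{fc}}^2)$ is a countably pracompact semitopological semigroup with continuous inversion.
   Context: For a cardinal $\lambda$, $\mathscr{I}_\lambda$ is the semigroup of all partial one-to-one transformations of $\lambda$ (injective maps $\alpha$ from a subset $\operatorname{dom}\alpha\subseteq\lambda$ into $\lambda$) with composition of partial maps $x(\alpha\beta)=(x\alpha)\beta$ for $x\in\operatorname{dom}(\alpha\beta)=\{y\in\operatorname{dom}\alpha : y\alpha\in\operatorname{dom}\beta\}$; the rank of $\alpha$ is $|\operatorname{ran}\alpha|$. $\mathscr{I}_\lambda^2=\{\alpha\in\mathscr{I}_\lambda : \operatorname{rank}\alpha\leqslant 2\}$ is an inverse semigroup whose zero $\mathbf{0}$ is the empty map; the inversion is $\alpha\mapsto\alpha^{-1}$ (the inverse partial map). The natural partial order is: $\alpha\preccurlyeq\beta$ iff $\alpha=\varepsilon\beta$ for some idempotent $\varepsilon$ (equivalently, $\alpha$ is a restriction of $\beta$), and ${\uparrow}_{\preccurlyeq}\alpha=\{\beta\in\mathscr{I}_\lambda^2:\alpha\preccurlyeq\beta\}$. For $\alpha\in\mathscr{I}_\lambda^2$ let $\mathscr{B}_{\mathsf{c}}^2(\alpha)$ be the family of all sets $U_\alpha(\alpha_1,\ldots,\alpha_k)={\uparrow}_{\preccurlyeq}\alpha\setminus({\uparrow}_{\preccurlyeq}\alpha_1\cup\cdots\cup{\uparrow}_{\preccurlyeq}\alpha_k)$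 with finitely many (possibly zero) $\alpha_1,\dots,\alpha_k\in{\uparrow}_{\preccurlyeq}\alpha\setminus\{\alpha\}$. For $a\in\lambda$ let $(a)\pi=\varepsilon_a$ be the identity partial map $\{a\}\to\{a\}$, and for $B\subseteq\lambda$ put $(B)\pi=\{\varepsilon_a: a\in B\}$. Fix an infinite subset $A\subseteq\lambda$. The topology $\tau_{\mathsf{fc}}^2$ on $\mathscr{I}_\lambda^2$ is the one with the following neighbourhood bases: at every $x\neq\mathbf{0}$ the base is $\mathscr{B}_{\mathsf{c}}^2(x)$; at $\mathbf{0}$ the base consists of all sets $$U(\mathbf{0})\setminus\big((B)\pi\cup\{\alpha_1,\ldots,\alpha_s\}\big),$$ where $U(\mathbf{0})\in\mathscr{B}_{\mathsf{c}}^2(\mathbf{0})$, $\alpha_1,\ldots,\alpha_s\in\mathscr{I}_\lambda^2\setminus\{\mathbf{0}\}$ (finitely many), and $B\subseteq\lambda$ is such that the symmetric difference $A\triangle B$ is finite. A semitopological semigroup is a semigroup with a topology for which the multiplication is separately continuous. A space $X$ is countably pracompact if there is a dense subset $D$ of $X$ such that every infinite subset of $D$ has an accumulation point in $X$. *)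

theory Defs
  imports "HOL-Analysis.Abstract_Topology"
begin

text \<open>
  A partial one-to-one transformation of a set \<open>L\<close> is represented by its graph. Maps act on the right,
  so the product \<open>\<alpha>\<beta>\<close> with \<open>x(\<alpha>\<beta>) = (x\<alpha>)\<beta>\<close> is the relational composition \<open>\<alpha> O \<beta>\<close>, the inverse partial map
  is \<open>\<alpha>\<inverse>\<close>, and the empty map is \<open>{}\<close>. A cardinal is represented by an arbitrary set of that cardinality.
\<close>

definition partial_injections :: "'a set \<Rightarrow> 'a rel set" where
  "partial_injections L = {\<alpha>. \<alpha> \<subseteq> L \<times> L \<and> single_valued \<alpha> \<and> single_valued (\<alpha>\<inverse>)}"

text \<open>Finiteness of the range is required explicitly because \<^const>\<open>card\<close> is \<open>0\<close> on infinite sets.\<close>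

definition I2 :: "'a set \<Rightarrow> 'a rel set" where
  "I2 L = {\<alpha> \<in> partial_injections L. finite (Range \<alpha>) \<and> card (Range \<alpha>) \<le> 2}"

definition natural_le :: "'a set \<Rightarrow> 'a rel \<Rightarrow> 'a rel \<Rightarrow> bool" where
  "natural_le L \<alpha> \<beta> \<longleftrightarrow> (\<exists>\<epsilon>\<in>I2 L. \<epsilon> O \<epsilon> = \<epsilon> \<and> \<alpha> = \<epsilon> O \<beta>)"

definition up :: "'a set \<Rightarrow> 'a rel \<Rightarrow> 'a rel set" where
  "up L \<alpha> = {\<beta> \<in> I2 L. natural_le L \<alpha> \<beta>}"

definition base_c :: "'a set \<Rightarrow> 'a rel \<Rightarrow> 'a rel set set" where
  "base_c L \<alpha> = {up L \<alpha> - (\<Union>\<beta>\<in>F. up L \<beta>) | F. finite F \<and> F \<subseteq> up L \<alpha> - {\<alpha>}}"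

definition point_idem :: "'a \<Rightarrow> 'a rel" where
  "point_idem a = {(a, a)}"

definition base_fc :: "'a set \<Rightarrow> 'a set \<Rightarrow> 'a rel \<Rightarrow> 'a rel set set" where
  "base_fc L A x =
     (if x = {}
      then {U - (point_idem ` B \<union> F) | U B F.
              U \<in> base_c L {} \<and> B \<subseteq> L \<and> finite (sym_diff A B) \<and> finite F \<and> F \<subseteq> I2 L - {{}}}
      else base_c L x)"

text \<open>
  The lemmas \<open>openin_tau_fc\<close>, \<open>topspace_tau_fc\<close>, \<open>mem_base_fc\<close> and \<open>openin_base_fc\<close> below show that this is, for \<open>A \<subseteq> L\<close>, a
  topology on \<open>I2 L\<close> for which \<open>base_fc L A x\<close> is a base of open neighbourhoods at each point \<open>x\<close>.
\<close>

definition tau_fc :: "'a set \<Rightarrow> 'a set \<Rightarrow> 'a rel topology" where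
  "tau_fc L A = topology (\<lambda>U. U \<subseteq> I2 L \<and> (\<forall>x\<in>U. \<exists>N\<in>base_fc L A x. N \<subseteq> U))"

definition semitopological_semigroup :: "'s topology \<Rightarrow> ('s \<Rightarrow> 's \<Rightarrow> 's) \<Rightarrow> bool" where
  "semitopological_semigroup X m \<longleftrightarrow>
     (\<forall>x\<in>topspace X. \<forall>y\<in>topspace X. m x y \<in> topspace X) \<and>
     (\<forall>x\<in>topspace X. \<forall>y\<in>topspace X. \<forall>z\<in>topspace X. m (m x y) z = m x (m y z)) \<and>
     (\<forall>a\<in>topspace X. continuous_map X X (\<lambda>x. m a x) \<and> continuous_map X X (\<lambda>x. m x a))"

definition countably_pracompact :: "'s topology \<Rightarrow> bool" where
  "countably_pracompact X \<longleftrightarrow>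
     (\<exists>D. D \<subseteq> topspace X \<and> X closure_of D = topspace X \<and>
          (\<forall>S. S \<subseteq> D \<and> infinite S \<longrightarrow> X derived_set_of S \<noteq> {}))"

lemma I2_subset: "\<beta> \<in> I2 L \<Longrightarrow> \<alpha> \<subseteq> \<beta> \<Longrightarrow> \<alpha> \<in> I2 L"
proof -
  assume b: "\<beta> \<in> I2 L" and s: "\<alpha> \<subseteq> \<beta>"
  have r: "Range \<alpha> \<subseteq> Range \<beta>" using s by blast
  have fin: "finite (Range \<beta>)" "card (Range \<beta>) \<le> 2" using b by (auto simp: I2_def)
  have "finite (Range \<alpha>)" using r fin finite_subset by blast
  moreover have "card (Range \<alpha>) \<le> 2" using card_mono[OF fin(1) r] fin(2) by linarith
  moreover have "single_valued \<alpha>" "single_valued (\<alpha>\<inverse>)" "\<alpha> \<subseteq> L \<times> L"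
    using b s single_valued_subset[of \<alpha> \<beta>] single_valued_subset[of "\<alpha>\<inverse>" "\<beta>\<inverse>"]
    by (auto simp: I2_def partial_injections_def)
  ultimately show ?thesis by (auto simp: I2_def partial_injections_def)
qed

lemma natural_le_iff:
  assumes "\<beta> \<in> I2 L"
  shows "natural_le L \<alpha> \<beta> \<longleftrightarrow> \<alpha> \<subseteq> \<beta>"
proof
  assume "natural_le L \<alpha> \<beta>"
  then obtain e where e: "e \<in> I2 L" "e O e = e" "\<alpha> = e O \<beta>" by (auto simp: natural_le_def)
  have sv: "single_valued e" "single_valued (e\<inverse>)"
    using e(1) by (auto simp: I2_def partial_injections_def)
  have "x = y" if xy: "(x, y) \<in> e" for x y
  proof -
    obtain z where "(x, z) \<in> e" "(z, y) \<in> e" using xy e(2) by blast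
    then have "(y, y) \<in> e" using xy sv(1) by (metis single_valuedD)
    then show ?thesis using xy sv(2) by (meson converse_iff single_valuedD)
  qed
  then show "\<alpha> \<subseteq> \<beta>" using e(3) by blast
next
  assume s: "\<alpha> \<subseteq> \<beta>"
  have a: "\<alpha> \<in> I2 L" using I2_subset assms s by blast
  let ?e = "Id_on (Domain \<alpha>)"
  have b: "single_valued \<beta>" using assms by (auto simp: I2_def partial_injections_def)
  have D: "Domain \<alpha> = (\<lambda>y. THE x. (x, y) \<in> \<alpha>) ` Range \<alpha>"
  proof -
    have "(THE x. (x, y) \<in> \<alpha>) = x" if "(x, y) \<in> \<alpha>" for x y
    proof (rule the_equality)
      show "(x, y) \<in> \<alpha>" by (rule that)
      have "single_valued (\<alpha>\<inverse>)" using a by (simp add: I2_def partial_injections_def)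
      then show "z = x" if "(z, y) \<in> \<alpha>" for z
        using that \<open>(x, y) \<in> \<alpha>\<close> by (meson converse_iff single_valuedD)
    qed
    then have "x \<in> Domain \<alpha> \<longleftrightarrow> (\<exists>y\<in>Range \<alpha>. x = (THE x. (x, y) \<in> \<alpha>))" for x
      unfolding Domain_iff Bex_def Range_iff by metis
    then show ?thesis unfolding image_def by blast
  qed
  have fin: "finite (Range \<alpha>)" "card (Range \<alpha>) \<le> 2" using a by (auto simp: I2_def)
  have "card (Domain \<alpha>) \<le> 2" unfolding D using card_image_le[OF fin(1)] fin(2) by (rule order_trans)
  moreover have "finite (Domain \<alpha>)" unfolding D using fin(1) by (rule finite_imageI)
  moreover have "Range ?e = Domain \<alpha>" by auto
  ultimately have "?e \<in> I2 L" using a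
    by (auto simp: I2_def partial_injections_def single_valued_def)
  moreover have "?e O ?e = ?e" by auto
  moreover have "\<alpha> = ?e O \<beta>" using s b by (auto simp: single_valued_def)
  ultimately show "natural_le L \<alpha> \<beta>" by (auto simp: natural_le_def)
qed

lemma up_eq: "up L \<alpha> = {\<beta> \<in> I2 L. \<alpha> \<subseteq> \<beta>}"
  by (auto simp: up_def natural_le_iff)

lemma base_c_Int:
  assumes "M \<in> base_c L x" "N \<in> base_c L x"
  shows "M \<inter> N \<in> base_c L x"
proof -
  obtain F where F: "M = up L x - (\<Union>\<beta>\<in>F. up L \<beta>)" "finite F" "F \<subseteq> up L x - {x}"
    using assms(1) by (auto simp: base_c_def)
  obtain G where G: "N = up L x - (\<Union>\<beta>\<in>G. up L \<beta>)" "finite G" "G \<subseteq> up L x - {x}"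
    using assms(2) by (auto simp: base_c_def)
  have "M \<inter> N = up L x - (\<Union>\<beta>\<in>F \<union> G. up L \<beta>)" using F(1) G(1) by auto
  moreover have "finite (F \<union> G)" "F \<union> G \<subseteq> up L x - {x}" using F G by auto
  ultimately show ?thesis unfolding base_c_def by blast
qed

lemma base_fc_Int:
  assumes "M \<in> base_fc L A x" "N \<in> base_fc L A x"
  shows "M \<inter> N \<in> base_fc L A x"
proof (cases "x = {}")
  case True
  obtain U B F where M: "M = U - (point_idem ` B \<union> F)" "U \<in> base_c L {}" "B \<subseteq> L"
      "finite (sym_diff A B)" "finite F" "F \<subseteq> I2 L - {{}}"
    using assms(1) True by (auto simp: base_fc_def)
  obtain V C G where N: "N = V - (point_idem ` C \<union> G)" "V \<in> base_c L {}" "C \<subseteq> L"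
      "finite (sym_diff A C)" "finite G" "G \<subseteq> I2 L - {{}}"
    using assms(2) True by (auto simp: base_fc_def)
  have "M \<inter> N = (U \<inter> V) - (point_idem ` (B \<union> C) \<union> (F \<union> G))" using M(1) N(1) by auto
  moreover have "finite (sym_diff A (B \<union> C))"
    by (rule finite_subset[of _ "sym_diff A B \<union> sym_diff A C"]) (use M(4) N(4) in auto)
  moreover have "U \<inter> V \<in> base_c L {}" using base_c_Int M(2) N(2) by blast
  moreover have "B \<union> C \<subseteq> L" "finite (F \<union> G)" "F \<union> G \<subseteq> I2 L - {{}}" using M N by auto
  ultimately show ?thesis unfolding base_fc_def if_P[OF True]
    by (intro CollectI exI[of _ "U \<inter> V"] exI[of _ "B \<union> C"] exI[of _ "F \<union> G"] conjI)
qed (use assms base_c_Int in \<open>auto simp: base_fc_def\<close>)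

lemma base_fc_subset: "N \<in> base_fc L A x \<Longrightarrow> N \<subseteq> I2 L"
  by (auto simp: base_fc_def base_c_def up_eq split: if_splits)

lemma mem_base_fc:
  assumes "x \<in> I2 L" "N \<in> base_fc L A x"
  shows "x \<in> N"
  using assms by (auto simp: base_fc_def base_c_def up_eq point_idem_def split: if_splits)

lemma istopology_tau_fc:
  "istopology (\<lambda>U. U \<subseteq> I2 L \<and> (\<forall>x\<in>U. \<exists>N\<in>base_fc L A x. N \<subseteq> U))"
  unfolding istopology_def
proof (intro conjI allI impI ballI)
  fix S T x
  assume S: "S \<subseteq> I2 L \<and> (\<forall>x\<in>S. \<exists>N\<in>base_fc L A x. N \<subseteq> S)"
    and T: "T \<subseteq> I2 L \<and> (\<forall>x\<in>T. \<exists>N\<in>base_fc L A x. N \<subseteq> T)"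
    and x: "x \<in> S \<inter> T"
  obtain M where M: "M \<in> base_fc L A x" "M \<subseteq> S" using S x by blast
  obtain N where N: "N \<in> base_fc L A x" "N \<subseteq> T" using T x by blast
  show "\<exists>N\<in>base_fc L A x. N \<subseteq> S \<inter> T"
    by (rule bexI[of _ "M \<inter> N"]) (use M N base_fc_Int in auto)
next
  fix K x
  assume K: "\<forall>S\<in>K. S \<subseteq> I2 L \<and> (\<forall>x\<in>S. \<exists>N\<in>base_fc L A x. N \<subseteq> S)" and x: "x \<in> \<Union>K"
  obtain S where S: "S \<in> K" "x \<in> S" using x by blast
  then obtain N where "N \<in> base_fc L A x" "N \<subseteq> S" using K by blast
  then show "\<exists>N\<in>base_fc L A x. N \<subseteq> \<Union>K" using S by blast
qed auto

lemma openin_tau_fc: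
  "openin (tau_fc L A) U \<longleftrightarrow> U \<subseteq> I2 L \<and> (\<forall>x\<in>U. \<exists>N\<in>base_fc L A x. N \<subseteq> U)"
  unfolding tau_fc_def by (simp only: topology_inverse'[OF istopology_tau_fc])

lemma base_fc_form:
  assumes "N \<in> base_fc L A x"
  obtains F B G where "N = up L x - ((\<Union>\<beta>\<in>F. up L \<beta>) \<union> point_idem ` B \<union> G)" "finite F" "finite G"
proof (cases "x = {}")
  case True
  obtain U B G where M: "N = U - (point_idem ` B \<union> G)" "U \<in> base_c L {}" "finite G"
    using assms True by (auto simp: base_fc_def)
  obtain F where "U = up L {} - (\<Union>\<beta>\<in>F. up L \<beta>)" "finite F"
    using M(2) by (auto simp: base_c_def)
  moreover from this have "N = up L x - ((\<Union>\<beta>\<in>F. up L \<beta>) \<union> point_idem ` B \<union> G)"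
    using M(1) True by blast
  ultimately show ?thesis using that M(3) by blast
next
  case False
  then obtain F where "N = up L x - (\<Union>\<beta>\<in>F. up L \<beta>)" "finite F"
    using assms by (auto simp: base_fc_def base_c_def)
  then show ?thesis using that[of F "{}" "{}"] by simp
qed

lemma openin_base_fc:
  assumes "N \<in> base_fc L A x"
  shows "openin (tau_fc L A) N"
proof -
  have "\<exists>M\<in>base_fc L A y. M \<subseteq> N" if y: "y \<in> N" for y
  proof (cases "y = x")
    case False
    obtain F B G where N: "N = up L x - ((\<Union>\<beta>\<in>F. up L \<beta>) \<union> point_idem ` B \<union> G)"
        "finite F" "finite G"
      by (rule base_fc_form[OF assms])
    have yx: "y \<in> I2 L" "x \<subseteq> y" "y \<noteq> {}" using y False by (auto simp: N up_eq)
    define H where "H = (G \<union> (\<union>) y ` F) \<inter> (up L y - {y})"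
    let ?M = "up L y - (\<Union>\<beta>\<in>H. up L \<beta>)"
    have "finite H" "H \<subseteq> up L y - {y}" unfolding H_def using N by auto
    then have "?M \<in> base_fc L A y" using yx(3) by (auto simp: base_fc_def base_c_def)
    moreover have "z \<in> N" if z: "z \<in> ?M" for z
    proof -
      have zy: "z \<in> I2 L" "y \<subseteq> z" using z by (auto simp: up_eq)
      have "z \<notin> up L \<beta>" if b: "\<beta> \<in> F" for \<beta>
      proof
        assume "z \<in> up L \<beta>"
        then have s: "y \<union> \<beta> \<subseteq> z" using zy by (auto simp: up_eq)
        then have "y \<union> \<beta> \<in> up L y" using I2_subset[OF zy(1) s] by (auto simp: up_eq)
        moreover have "y \<union> \<beta> \<noteq> y" using y b yx(1) by (auto simp: N up_eq)
        ultimately have "y \<union> \<beta> \<in> H" using b by (auto simp: H_def)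
        then show False using z s zy(1) by (auto simp: up_eq)
      qed
      moreover have "z \<notin> point_idem ` B"
      proof
        assume "z \<in> point_idem ` B"
        then have "z = y" using zy(2) yx(3) by (auto simp: point_idem_def)
        then show False using y \<open>z \<in> point_idem ` B\<close> by (auto simp: N)
      qed
      moreover have "z \<notin> G"
      proof
        assume g: "z \<in> G"
        then have "z \<noteq> y" using y by (auto simp: N)
        then have "z \<in> H" using g zy by (auto simp: H_def up_eq)
        then show False using z zy by (auto simp: up_eq)
      qed
      ultimately show ?thesis using zy yx(2) by (auto simp: N up_eq)
    qed
    ultimately show ?thesis by blast
  qed (use assms in auto)
  then show ?thesis using base_fc_subset[OF assms] by (simp add: openin_tau_fc)
qed

lemma topspace_tau_fc:
  assumes "A \<subseteq> L"
  shows "topspace (tau_fc L A) = I2 L"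
proof
  have c: "up L x \<in> base_c L x" for x
    unfolding base_c_def by (rule CollectI, rule exI[of _ "{}"]) simp
  have ne: "\<exists>N. N \<in> base_fc L A x" for x
  proof (cases "x = {}")
    case True
    have "finite (sym_diff A A)" by simp
    then have "up L {} - (point_idem ` A \<union> {}) \<in> base_fc L A x"
      unfolding base_fc_def if_P[OF True] using c[of "{}"] assms by blast
    then show ?thesis by (rule exI)
  next
    case False
    then show ?thesis using c[of x] by (auto simp: base_fc_def)
  qed
  have "\<exists>N\<in>base_fc L A x. N \<subseteq> I2 L" for x
    using ne[of x] base_fc_subset[of _ L A x] by blast
  then have "openin (tau_fc L A) (I2 L)" by (simp add: openin_tau_fc)
  then show "I2 L \<subseteq> topspace (tau_fc L A)" by (rule openin_subset)
  show "topspace (tau_fc L A) \<subseteq> I2 L"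
    using openin_topspace[of "tau_fc L A"] unfolding openin_tau_fc by (rule conjunct1)
qed

end

(* A basic neighbourhood of x arises from the cone of x by removing finitely many cones and points
   and, only when x is the empty map, point idempotents. For a left translation, a y extends b only
   if y extends inverse(a) b, so the preimage of a removed cone is covered by one removed cone; and
   a y can be a point idempotent only over one of the finitely many points of dom a. Inversion
   preserves the bases, and it turns right translations into left ones. For countable pracompactness
   take D to be the maps of rank 2: it contains no point idempotent, and an infinite subset S of D
   accumulates at any x of maximal rank among the maps with infinitely many extensions in S. *)

theory Submission
  imports Defs
begin

section \<open>Partial injections of rank at most two\<close>

text \<open>Since \<open>\<alpha>\<inverse>\<close> is single-valued, the second projection is
  injective on the graph, so the rank is \<open>card \<alpha>\<close>. Later arguments can thus
  measure rank on the graph itself.\<close>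

lemma I2_imp:
  assumes "\<alpha> \<in> I2 L"
  shows "finite \<alpha>" "card \<alpha> \<le> 2" "\<alpha> \<subseteq> L \<times> L" "single_valued \<alpha>" "single_valued (\<alpha>\<inverse>)"
proof -
  have sv: "\<alpha> \<subseteq> L \<times> L" "single_valued \<alpha>" "single_valued (\<alpha>\<inverse>)"
    and fin: "finite (Range \<alpha>)" "card (Range \<alpha>) \<le> 2"
    using assms by (auto simp: I2_def partial_injections_def)
  have inj: "inj_on snd \<alpha>"
    using sv(3) by (auto simp: inj_on_def single_valued_def)
  show "finite \<alpha>" "card \<alpha> \<le> 2"
    using fin finite_image_iff[OF inj] card_image[OF inj] by (simp_all add: Range_snd)
  show "\<alpha> \<subseteq> L \<times> L" "single_valued \<alpha>" "single_valued (\<alpha>\<inverse>)" by (fact sv)+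
qed

lemma I2_iff:
  "\<alpha> \<in> I2 L \<longleftrightarrow>
    finite \<alpha> \<and> card \<alpha> \<le> 2 \<and> \<alpha> \<subseteq> L \<times> L \<and> single_valued \<alpha> \<and> single_valued (\<alpha>\<inverse>)"
proof
  assume *: "finite \<alpha> \<and> card \<alpha> \<le> 2 \<and> \<alpha> \<subseteq> L \<times> L \<and> single_valued \<alpha> \<and> single_valued (\<alpha>\<inverse>)"
  then have "card (Range \<alpha>) \<le> 2"
    using card_image_le[of \<alpha> snd] by (simp add: Range_snd)
  then show "\<alpha> \<in> I2 L" using * by (simp add: I2_def partial_injections_def finite_Range)
qed (simp add: I2_imp)

lemma empty_in_I2: "{} \<in> I2 L"
  by (simp add: I2_iff)

lemma I2_converse: "\<alpha> \<in> I2 L \<Longrightarrow> \<alpha>\<inverse> \<in> I2 L"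
  by (auto simp: I2_iff)

lemma I2_relcomp:
  assumes "\<alpha> \<in> I2 L" "\<beta> \<in> I2 L"
  shows "\<alpha> O \<beta> \<in> I2 L"
proof -
  have "Range (\<alpha> O \<beta>) \<subseteq> Range \<beta>" by blast
  moreover have "finite (Range \<beta>)" "card (Range \<beta>) \<le> 2" using assms(2) by (auto simp: I2_def)
  ultimately have "finite (Range (\<alpha> O \<beta>))" "card (Range (\<alpha> O \<beta>)) \<le> 2"
    by (meson finite_subset card_mono order_trans)+
  moreover have "\<alpha> O \<beta> \<subseteq> L \<times> L" using I2_imp(3) assms by blast
  moreover have "single_valued (\<alpha> O \<beta>)" "single_valued ((\<alpha> O \<beta>)\<inverse>)"
    using assms I2_imp(4,5) by (auto simp: converse_relcomp intro!: single_valued_relcomp)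
  ultimately show ?thesis by (simp add: I2_def partial_injections_def)
qed

section \<open>Shrinking and building basic neighbourhoods\<close>

text \<open>A normal form treating zero and nonzero points alike: isolated removed points are
  absorbed into removed cones. The conditions on \<open>F\<close> and \<open>B\<close> record that
  \<open>x\<close> itself survives the removal.\<close>

lemma base_fc_form':
  assumes "N \<in> base_fc L A x" "x \<in> I2 L"
  obtains F B where "finite F" "F \<subseteq> I2 L" "\<And>\<beta>. \<beta> \<in> F \<Longrightarrow> \<not> \<beta> \<subseteq> x"
    "up L x - (\<Union>\<beta>\<in>F. up L \<beta>) - point_idem ` B \<subseteq> N" "x \<notin> point_idem ` B"
proof -
  obtain F B G where N: "N = up L x - ((\<Union>\<beta>\<in>F. up L \<beta>) \<union> point_idem ` B \<union> G)"
    and fin: "finite F" "finite G"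
    by (rule base_fc_form[OF assms(1)])
  have xN: "x \<in> N" using mem_base_fc assms by blast
  \<comment> \<open>A point of \<open>G\<close> above \<open>x\<close> differs from
    \<open>x\<close>, so its whole cone may be removed without losing \<open>x\<close>; points of
    \<open>G\<close> not above \<open>x\<close> are outside the cone anyway. A
    \<open>\<beta>\<close> outside \<open>I2 L\<close> has an empty cone.\<close>
  let ?F = "{\<beta> \<in> F \<union> (G \<inter> up L x). \<beta> \<in> I2 L}"
  have "up L x - (\<Union>\<beta>\<in>?F. up L \<beta>) - point_idem ` B \<subseteq> N"
  proof
    fix y assume y: "y \<in> up L x - (\<Union>\<beta>\<in>?F. up L \<beta>) - point_idem ` B"
    have "y \<notin> up L \<beta>" if "\<beta> \<in> F" for \<beta>
    proof
      assume *: "y \<in> up L \<beta>"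
      then have "\<beta> \<in> I2 L" using I2_subset by (auto simp: up_eq)
      then show False using y * that by auto
    qed
    moreover have "y \<notin> G"
    proof
      assume "y \<in> G"
      then have "y \<in> ?F" "y \<in> up L y" using y by (auto simp: up_eq)
      then show False using y by blast
    qed
    ultimately show "y \<in> N" using y by (auto simp: N)
  qed
  moreover have "\<not> \<beta> \<subseteq> x" if "\<beta> \<in> ?F" for \<beta>
    using that xN by (auto simp: N up_eq)
  moreover have "finite ?F" "?F \<subseteq> I2 L" "x \<notin> point_idem ` B" using fin xN by (auto simp: N)
  ultimately show ?thesis using that[of ?F B] by blast
qed

text \<open>Among the maps above \<open>x\<close>, lying above \<open>h\<close> means lying above
  \<open>x \<union> h\<close>, so it suffices to remove the cones of these unions. The members of
  \<open>H\<close> may therefore be arbitrary relations, incomparable with \<open>x\<close>.\<close>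

lemma base_fc_avoiding:
  assumes "x \<in> I2 L" "A \<subseteq> L" "finite H" "\<And>h. h \<in> H \<Longrightarrow> \<not> h \<subseteq> x"
  obtains N where "N \<in> base_fc L A x" "N \<subseteq> up L x" "\<And>y h. y \<in> N \<Longrightarrow> h \<in> H \<Longrightarrow> \<not> h \<subseteq> y"
proof -
  define H' where "H' = (\<union>) x ` H \<inter> I2 L"
  define U where "U = up L x - (\<Union>\<beta>\<in>H'. up L \<beta>)"
  have "finite H'" "H' \<subseteq> up L x - {x}"
    using assms(3,4) by (auto simp: H'_def up_eq)
  then have U: "U \<in> base_c L x" by (auto simp: base_c_def U_def)
  have avoid: "\<not> h \<subseteq> y" if y: "y \<in> U" and h: "h \<in> H" for y h
  proof
    assume "h \<subseteq> y"
    then have s: "x \<union> h \<subseteq> y" and "y \<in> I2 L" using y by (auto simp: U_def up_eq)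
    then have "x \<union> h \<in> H'" using I2_subset[OF _ s] h by (auto simp: H'_def)
    then show False using y s by (auto simp: U_def up_eq)
  qed
  show ?thesis
  proof (cases "x = {}")
    case True
    \<comment> \<open>At zero a basic set must also omit point idempotents; \<open>B = A\<close> is
      an admissible choice and only shrinks \<open>U\<close>.\<close>
    have "finite (sym_diff A A)" by simp
    then have "U - (point_idem ` A \<union> {}) \<in> base_fc L A x"
      unfolding base_fc_def if_P[OF True] using U True assms(2) by blast
    then show ?thesis by (rule that) (use avoid in \<open>auto simp: U_def\<close>)
  next
    case False
    then have "U \<in> base_fc L A x" using U by (simp add: base_fc_def)
    then show ?thesis by (rule that) (use avoid in \<open>auto simp: U_def\<close>)
  qed
qed

section \<open>Continuity of left translations\<close>

lemma continuous_map_tau_fcI: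
  assumes "A \<subseteq> L" "\<And>x. x \<in> I2 L \<Longrightarrow> f x \<in> I2 L"
    and "\<And>x W. x \<in> I2 L \<Longrightarrow> W \<in> base_fc L A (f x) \<Longrightarrow> \<exists>N\<in>base_fc L A x. f ` N \<subseteq> W"
  shows "continuous_map (tau_fc L A) (tau_fc L A) f"
proof -
  have "\<exists>N\<in>base_fc L A x. N \<subseteq> {x \<in> I2 L. f x \<in> U}"
    if U: "openin (tau_fc L A) U" and x: "x \<in> I2 L" "f x \<in> U" for U x
  proof -
    obtain W where W: "W \<in> base_fc L A (f x)" "W \<subseteq> U" using U x by (auto simp: openin_tau_fc)
    obtain N where "N \<in> base_fc L A x" "f ` N \<subseteq> W" using assms(3)[OF x(1) W(1)] by blast
    then show ?thesis using W(2) base_fc_subset[of N L A x] by blast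
  qed
  then show ?thesis
    using assms(1,2) by (auto simp: continuous_map_def topspace_tau_fc openin_tau_fc Pi_iff)
qed

lemma continuous_map_left_translation:
  assumes "A \<subseteq> L" "a \<in> I2 L"
  shows "continuous_map (tau_fc L A) (tau_fc L A) (\<lambda>x. a O x)"
proof (rule continuous_map_tau_fcI)
  fix x W
  assume x: "x \<in> I2 L" and W: "W \<in> base_fc L A (a O x)"
  have ax: "a O x \<in> I2 L" using assms(2) x by (rule I2_relcomp)
  obtain F B where F: "finite F" "\<And>\<beta>. \<beta> \<in> F \<Longrightarrow> \<not> \<beta> \<subseteq> a O x"
    and sub: "up L (a O x) - (\<Union>\<beta>\<in>F. up L \<beta>) - point_idem ` B \<subseteq> W"
    and B: "a O x \<notin> point_idem ` B"
    using base_fc_form'[OF W ax] by metis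
  \<comment> \<open>\<open>E\<close> collects the obstacles that \<open>a O y\<close> could meet. A
    \<open>\<beta>\<close> whose domain leaves \<open>Domain a\<close> is never below
    \<open>a O y\<close>, and although \<open>B\<close> may be infinite, only idempotents at points
    of the finite set \<open>Domain a\<close> matter.\<close>
  define E where "E = {\<beta> \<in> F \<union> point_idem ` Domain a. Domain \<beta> \<subseteq> Domain a \<and> \<not> \<beta> \<subseteq> a O x}"
  have finE: "finite ((\<lambda>\<beta>. a\<inverse> O \<beta>) ` E)"
    using F(1) I2_imp(1)[OF assms(2)] by (simp add: E_def finite_Domain)
  have notin: "\<not> h \<subseteq> x" if h: "h \<in> (\<lambda>\<beta>. a\<inverse> O \<beta>) ` E" for h
  proof
    assume s: "h \<subseteq> x"
    obtain \<beta> where \<beta>: "\<beta> \<in> E" "h = a\<inverse> O \<beta>" using h by blast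
    \<comment> \<open>As \<open>Domain \<beta> \<subseteq> Domain a\<close>, each pair of
      \<open>\<beta>\<close> factors through \<open>a\<close> and
      \<open>a\<inverse> O \<beta>\<close>.\<close>
    have "(u, v) \<in> a O x" if uv: "(u, v) \<in> \<beta>" for u v
    proof -
      have "Domain \<beta> \<subseteq> Domain a" using \<beta>(1) by (simp add: E_def)
      then obtain w where w: "(u, w) \<in> a" using uv by blast
      then have "(w, v) \<in> x" using uv \<beta>(2) s by blast
      then show ?thesis using w by blast
    qed
    then have "\<beta> \<subseteq> a O x" by (rule subrelI)
    then show False using \<beta>(1) by (simp add: E_def)
  qed
  obtain N where N: "N \<in> base_fc L A x" "N \<subseteq> up L x"
    "\<And>y h. y \<in> N \<Longrightarrow> h \<in> (\<lambda>\<beta>. a\<inverse> O \<beta>) ` E \<Longrightarrow> \<not> h \<subseteq> y"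
    using base_fc_avoiding[OF x assms(1) finE notin] by metis
  have "a O y \<in> W" if y: "y \<in> N" for y
  proof -
    have yI: "y \<in> I2 L" "x \<subseteq> y" using y N(2) by (auto simp: up_eq)
    have noE: "\<not> \<beta> \<subseteq> a O y" if "\<beta> \<in> E" for \<beta>
    proof
      assume s: "\<beta> \<subseteq> a O y"
      \<comment> \<open>Single-valuedness of \<open>a\<close> makes \<open>a\<inverse> O a\<close> a
        partial identity, so \<open>\<beta> \<subseteq> a O y\<close> pulls back to
        \<open>y\<close>.\<close>
      have "a\<inverse> O \<beta> \<subseteq> y"
      proof
        fix p assume "p \<in> a\<inverse> O \<beta>"
        then obtain u v w where p: "p = (w, v)" "(u, w) \<in> a" "(u, v) \<in> \<beta>" by blast
        then obtain w' where "(u, w') \<in> a" "(w', v) \<in> y" using s by blast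
        then show "p \<in> y" using p I2_imp(4)[OF assms(2)] by (metis single_valuedD)
      qed
      then show False using N(3)[OF y] that by blast
    qed
    have noF: "\<not> \<beta> \<subseteq> a O y" if "\<beta> \<in> F" for \<beta>
    proof
      assume "\<beta> \<subseteq> a O y"
      then show False using noE[of \<beta>] that F(2)[OF that] by (auto simp: E_def)
    qed
    have "a O y \<notin> point_idem ` B"
    proof
      assume *: "a O y \<in> point_idem ` B"
      then obtain b where b: "a O y = {(b, b)}" by (auto simp: point_idem_def)
      \<comment> \<open>The point idempotent \<open>a O y\<close> is strictly above
        \<open>a O x\<close>, hence not below it, which is what membership in \<open>E\<close>
        requires.\<close>
      have "a O x \<subseteq> a O y" "a O x \<noteq> a O y" using yI(2) B * by auto
      moreover have "b \<in> Domain a" using b by blast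
      ultimately have "a O y \<in> E" using b unfolding E_def by (auto simp: point_idem_def)
      then show False using noE by blast
    qed
    moreover have "a O y \<in> up L (a O x)"
      using I2_relcomp[OF assms(2) yI(1)] yI(2) by (auto simp: up_eq)
    ultimately show ?thesis using sub noF by (auto simp: up_eq)
  qed
  then show "\<exists>N\<in>base_fc L A x. (\<lambda>x. a O x) ` N \<subseteq> W" using N(1) by blast
qed (use assms I2_relcomp in auto)

section \<open>Continuity of inversion and of right translations\<close>

text \<open>Inversion preserves inclusion, which gives one direction; being an involution, it turns
  the same inclusion at \<open>x\<inverse>\<close> into the other.\<close>

lemma converse_image_up: "converse ` up L x = up L (x\<inverse>)"
proof -
  have sub: "converse ` up L y \<subseteq> up L (y\<inverse>)" for y
    by (auto simp: up_eq I2_converse)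
  have "up L (x\<inverse>) = converse ` converse ` up L (x\<inverse>)" by (simp add: image_image)
  also have "\<dots> \<subseteq> converse ` up L x" using image_mono[OF sub[of "x\<inverse>"], of converse] by simp
  finally show ?thesis using sub[of x] by blast
qed

lemma inj_converse: "inj converse"
  by (metis converse_converse injI)

lemma converse_image_base_c:
  assumes "W \<in> base_c L x"
  shows "converse ` W \<in> base_c L (x\<inverse>)"
proof -
  obtain F where F: "W = up L x - (\<Union>\<beta>\<in>F. up L \<beta>)" "finite F" "F \<subseteq> up L x - {x}"
    using assms by (auto simp: base_c_def)
  have "converse ` W = up L (x\<inverse>) - (\<Union>\<beta>\<in>converse ` F. up L \<beta>)"
    by (simp add: F(1) image_set_diff[OF inj_converse] image_UN converse_image_up)
  moreover have "converse ` F \<subseteq> up L (x\<inverse>) - {x\<inverse>}"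
    using F(3) converse_image_up[of L x] by auto
  ultimately show ?thesis using F(2) unfolding base_c_def by blast
qed

lemma converse_image_base_fc:
  assumes "W \<in> base_fc L A x"
  shows "converse ` W \<in> base_fc L A (x\<inverse>)"
proof (cases "x = {}")
  case True
  obtain U B F where W: "W = U - (point_idem ` B \<union> F)" "U \<in> base_c L {}" "B \<subseteq> L"
      "finite (sym_diff A B)" "finite F" "F \<subseteq> I2 L - {{}}"
    using assms True by (auto simp: base_fc_def)
  \<comment> \<open>Point idempotents are their own inverses, so the same \<open>B\<close> serves
    for the image.\<close>
  have "converse ` point_idem ` B = point_idem ` B"
    unfolding image_image by (rule image_cong) (auto simp: point_idem_def)
  then have "converse ` W = converse ` U - (point_idem ` B \<union> converse ` F)"
    by (simp add: W(1) image_set_diff[OF inj_converse] image_Un)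
  moreover have "converse ` U \<in> base_c L {}" using converse_image_base_c[OF W(2)] by simp
  moreover have "finite (converse ` F)" using W(5) by simp
  moreover have "converse ` F \<subseteq> I2 L - {{}}"
    using W(6) I2_converse by fastforce
  moreover have x: "x\<inverse> = {}" using True by simp
  ultimately show ?thesis unfolding base_fc_def if_P[OF x] using W(3,4)
    by (intro CollectI exI[of _ "converse ` U"] exI[of _ B] exI[of _ "converse ` F"] conjI)
next
  case False
  then have "x\<inverse> \<noteq> {}" by auto
  then show ?thesis using assms False by (simp add: base_fc_def converse_image_base_c)
qed

lemma continuous_map_converse:
  assumes "A \<subseteq> L"
  shows "continuous_map (tau_fc L A) (tau_fc L A) converse"
proof (rule continuous_map_tau_fcI[OF assms])
  fix x W
  assume "W \<in> base_fc L A (x\<inverse>)"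
  from converse_image_base_fc[OF this]
  show "\<exists>N\<in>base_fc L A x. converse ` N \<subseteq> W" by (intro bexI) auto
qed (rule I2_converse)

lemma continuous_map_right_translation:
  assumes "A \<subseteq> L" "a \<in> I2 L"
  shows "continuous_map (tau_fc L A) (tau_fc L A) (\<lambda>x. x O a)"
proof -
  have "(\<lambda>x. x O a) = converse \<circ> (\<lambda>x. a\<inverse> O x) \<circ> converse"
    by (simp add: fun_eq_iff converse_relcomp)
  then show ?thesis
    using continuous_map_compose continuous_map_converse[OF assms(1)]
      continuous_map_left_translation[OF assms(1) I2_converse[OF assms(2)]] by metis
qed

section \<open>Density and accumulation of the maps of rank two\<close>

text \<open>Supplies the witnesses for density. Each step adds a fixed point \<open>r\<close>
  outside \<open>K\<close> and outside the field built so far, which keeps the map injective;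
  \<open>r\<close> exists because \<open>L\<close> is infinite.\<close>

lemma I2_extend_fresh:
  assumes "x \<in> I2 L" "infinite L" "finite K" "n \<le> 2 - card x"
  shows "\<exists>y\<in>I2 L. x \<subseteq> y \<and> card y = card x + n \<and> y - x \<subseteq> Id_on (- K)"
  using assms(4)
proof (induction n)
  case 0
  then show ?case using assms(1) by auto
next
  case (Suc n)
  then obtain y where y: "y \<in> I2 L" "x \<subseteq> y" "card y = card x + n" "y - x \<subseteq> Id_on (- K)"
    by auto
  have "finite (K \<union> Field y)"
    using assms(3) I2_imp(1)[OF y(1)] by (simp add: finite_Field)
  then obtain r where r: "r \<in> L" "r \<notin> K" "r \<notin> Field y"
    using assms(2) by (metis UnCI finite_subset subsetI)
  then have new: "(r, r) \<notin> y" by (auto simp: Field_def)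
  have c: "card (insert (r, r) y) = card x + Suc n"
    using new y(3) I2_imp(1)[OF y(1)] by simp
  moreover have "single_valued (insert (r, r) y)" "single_valued ((insert (r, r) y)\<inverse>)"
    using I2_imp(4,5)[OF y(1)] r(3) unfolding single_valued_def Field_def by auto
  ultimately have "insert (r, r) y \<in> I2 L"
    using I2_imp(1,3)[OF y(1)] r(1) Suc.prems by (auto simp: I2_iff)
  then show ?case using c y(2,4) r(2) by (intro bexI[of _ "insert (r, r) y"]) auto
qed

lemma dense_rank_two:
  assumes "A \<subseteq> L" "infinite L"
  shows "tau_fc L A closure_of {\<alpha> \<in> I2 L. card \<alpha> = 2} = topspace (tau_fc L A)"
proof -
  have "\<exists>y\<in>{\<alpha> \<in> I2 L. card \<alpha> = 2}. y \<in> T"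
    if x: "x \<in> I2 L" and T: "x \<in> T" "openin (tau_fc L A) T" for x T
  proof -
    obtain N where N: "N \<in> base_fc L A x" "N \<subseteq> T" using T by (auto simp: openin_tau_fc)
    obtain F B where F: "finite F" "F \<subseteq> I2 L" "\<And>\<beta>. \<beta> \<in> F \<Longrightarrow> \<not> \<beta> \<subseteq> x"
      and sub: "up L x - (\<Union>\<beta>\<in>F. up L \<beta>) - point_idem ` B \<subseteq> N"
      using base_fc_form'[OF N(1) x] by metis
    have "finite (\<Union>\<beta>\<in>F. Field \<beta>)" using F(1,2) I2_imp(1) by (auto intro!: finite_Field)
    \<comment> \<open>Reflexivity selects \<open>n = 2 - card x\<close>, so \<open>y\<close> has
      rank exactly two.\<close>
    from I2_extend_fresh[OF x assms(2) this order_refl] obtain y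
      where y: "y \<in> I2 L" "x \<subseteq> y" "card y = 2" "y - x \<subseteq> Id_on (- (\<Union>\<beta>\<in>F. Field \<beta>))"
      using I2_imp(2)[OF x] by auto
    \<comment> \<open>No added pair meets the field of \<open>\<beta>\<close>, so
      \<open>\<beta> \<subseteq> y\<close> would force \<open>\<beta> \<subseteq> x\<close>.\<close>
    have "\<not> \<beta> \<subseteq> y" if "\<beta> \<in> F" for \<beta>
      using F(3)[OF that] y(4) that by (fastforce simp: Field_def)
    moreover have "y \<notin> point_idem ` B" using y(3) by (auto simp: point_idem_def)
    ultimately have "y \<in> T" using sub N(2) y(1,2) by (auto simp: up_eq)
    then show ?thesis using y by blast
  qed
  then show ?thesis by (auto simp: closure_of_def topspace_tau_fc[OF assms(1)])
qed

lemma rank_two_accumulation: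
  assumes "A \<subseteq> L" "S \<subseteq> {\<alpha> \<in> I2 L. card \<alpha> = 2}" "infinite S"
  shows "tau_fc L A derived_set_of S \<noteq> {}"
proof -
  let ?P = "\<lambda>x. x \<in> I2 L \<and> infinite {s \<in> S. x \<subseteq> s}"
  have "?P {}" using assms(3) empty_in_I2 by simp
  \<comment> \<open>Ranks are at most two, so a candidate of greatest rank exists; the bound is
    stated strictly, hence \<open>3\<close>.\<close>
  moreover have "\<forall>x. ?P x \<longrightarrow> card x < 3" using I2_imp(2) by fastforce
  ultimately obtain x where x: "x \<in> I2 L" "infinite {s \<in> S. x \<subseteq> s}"
    and max: "\<And>z. ?P z \<Longrightarrow> card z \<le> card x"
    using ex_has_greatest_nat[of ?P "{}" card 3] by auto
  have "\<exists>y. y \<noteq> x \<and> y \<in> S \<and> y \<in> T" if T: "x \<in> T" "openin (tau_fc L A) T" for T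
  proof -
    obtain N where N: "N \<in> base_fc L A x" "N \<subseteq> T" using T by (auto simp: openin_tau_fc)
    obtain F B where F: "finite F" "\<And>\<beta>. \<beta> \<in> F \<Longrightarrow> \<not> \<beta> \<subseteq> x"
      and sub: "up L x - (\<Union>\<beta>\<in>F. up L \<beta>) - point_idem ` B \<subseteq> N"
      using base_fc_form'[OF N(1) x(1)] by metis
    \<comment> \<open>Maximality enters here: \<open>x \<union> \<beta>\<close> has larger rank than
      \<open>x\<close>, so it cannot have infinitely many extensions in \<open>S\<close>.\<close>
    have fin: "finite {s \<in> S. x \<union> \<beta> \<subseteq> s}" if \<beta>: "\<beta> \<in> F" for \<beta>
    proof (rule ccontr)
      assume inf: "infinite {s \<in> S. x \<union> \<beta> \<subseteq> s}"
      then obtain s where "s \<in> S" "x \<union> \<beta> \<subseteq> s" using infinite_imp_nonempty by blast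
      then have I: "x \<union> \<beta> \<in> I2 L" using I2_subset[of s] assms(2) by blast
      have "x \<subset> x \<union> \<beta>" using F(2)[OF \<beta>] by blast
      then have "card x < card (x \<union> \<beta>)" by (rule psubset_card_mono[OF I2_imp(1)[OF I]])
      then show False using max[of "x \<union> \<beta>"] I inf by simp
    qed
    \<comment> \<open>Rank two rules out point idempotents, so an extension of \<open>x\<close> in
      \<open>S\<close> can miss \<open>N\<close> only through one of the finitely many removed
      cones.\<close>
    have "{s \<in> S. x \<subseteq> s} \<subseteq> (S \<inter> N) \<union> (\<Union>\<beta>\<in>F. {s \<in> S. x \<union> \<beta> \<subseteq> s})"
    proof
      fix s assume s: "s \<in> {s \<in> S. x \<subseteq> s}"
      then have "s \<notin> point_idem ` B" "s \<in> up L x"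
        using assms(2) by (auto simp: point_idem_def up_eq)
      then show "s \<in> (S \<inter> N) \<union> (\<Union>\<beta>\<in>F. {s \<in> S. x \<union> \<beta> \<subseteq> s})"
        using s sub by (auto simp: up_eq)
    qed
    moreover have "finite (\<Union>\<beta>\<in>F. {s \<in> S. x \<union> \<beta> \<subseteq> s})" using F(1) fin by (rule finite_UN_I)
    ultimately have "infinite (S \<inter> N)" using x(2) by (meson finite_UnI finite_subset)
    then have "infinite (S \<inter> N - {x})" by simp
    then have "S \<inter> N - {x} \<noteq> {}" by (rule infinite_imp_nonempty)
    then show ?thesis using N(2) by blast
  qed
  then have "x \<in> tau_fc L A derived_set_of S"
    using x(1) by (auto simp: in_derived_set_of topspace_tau_fc[OF assms(1)])
  then show ?thesis by blast
qed

theorem proposition9: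
  fixes L A :: "'a set"
  assumes "infinite L" and "A \<subseteq> L" and "infinite A"
  shows "semitopological_semigroup (tau_fc L A) (O) \<and>
         continuous_map (tau_fc L A) (tau_fc L A) converse \<and>
         countably_pracompact (tau_fc L A)"
proof (intro conjI)
  note [simp] = topspace_tau_fc[OF assms(2)]
  show "semitopological_semigroup (tau_fc L A) (O)"
    using assms(2)
    by (auto simp: semitopological_semigroup_def I2_relcomp O_assoc
        intro: continuous_map_left_translation continuous_map_right_translation)
  show "continuous_map (tau_fc L A) (tau_fc L A) converse"
    using assms(2) by (rule continuous_map_converse)
  show "countably_pracompact (tau_fc L A)"
    unfolding countably_pracompact_def
    using dense_rank_two[OF assms(2,1)] rank_two_accumulation[OF assms(2)]
    by (intro exI[of _ "{\<alpha> \<in> I2 L. card \<alpha> = 2}"]) auto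
qed

end
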